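(* Let $X$ be a non-empty Lindelöf locally compact Hausdorff space, let $\mathcal{I}$ be a Riesz ideal and unital subalgebra of $C(X)$ and $\mathcal{A}$ an ordered unital algebra. If $\Phi,\Psi\colon\mathcal{I}\to\mathcal{A}$ are two unital morphisms of algebras that are strictly $\mathcal{I}$-continuous and that coincide on a point-separating subset $S$ of $\mathcal{I}$, then $\Phi=\Psi$.
   Context: $C(X)$ is the algebra of real-valued continuous functions on $X$ with pointwise operations and pointwise order; $|f|$ is the pointwise absolute value. A Riesz ideal of $C(X)$ is a linear subspace $\mathcal{I}\subseteq C(X)$ such that $f\in C(X)$, $g\in\mathcal{I}$ and $|f|\le|g|$ imply $f\in\mathcal{I}$. A unital subalgebra is a linear subspace closed under multiplication and containing the constant function $1$. A subset $S\subseteq C(X)$ is point-separating if for all $x\neq y$ in $X$ there is $s\in S$ with $s(x)\ne s(y)$. An ordered vector space is a real vector space with a partial order $\le$ such that $u\le v$ implies $\lambda u\le\lambda v$ and $u+w\le v+w$ for all $\lambda\in[0,\infty)$ and all vectors $w$. An ordered unital algebra is a unital associative (not necessarily commutative) algebra $\mathcal{A}$ over $\mathbb{R}$ with a partial order making it an ordered vector space and such that $a^2\ge 0$ for all $a\in\mathcal{A}$. A linear map $\Phi\colon\mathcal{I}\to\mathcal{A}$ is positive if $\Phi(f)\ge0$ for all $f\in\mathcal{I}$ with $f\ge 0$ (unital algebra morphisms $\mathcal{I}\to\mathcal{A}$ as in the claim are automatically positive). A positive linear map $\Phi\colon\mathcal{I}\to\mathcal{A}$ is strictly $\mathcal{I}$-continuous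 if for every decreasing sequence $(f_k)_{k\in\mathbb{N}}$ in $\mathcal{I}$ with pointwise infimum $0$ (i.e. $\inf_k f_k(x)=0$ for all $x\in X$), the decreasing sequence $(\Phi(f_k))_{k\in\mathbb{N}}$ in $\mathcal{A}$ has infimum $0$. *)

theory Defs
  imports "HOL-Analysis.Analysis" "HOL-Library.Lub_Glb"
begin

text \<open>
  The library class \<open>real_algebra_1\<close> requires \<open>0 \<noteq> 1\<close>. We only combine \<open>real_algebra\<close>
  with \<open>monoid_mult\<close>, so that the zero algebra is an ordered unital algebra, too.
  Of the two scaling axioms of \<open>ordered_real_vector\<close>, the second one follows from
  the first one and the translation invariance of the order.
\<close>
class ordered_unital_algebra = real_algebra + monoid_mult + ordered_real_vector +
  assumes square_nonneg: "0 \<le> a\<^sup>2"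

definition continuous_functions :: "('x::topological_space \<Rightarrow> real) set"
  where "continuous_functions = {f. continuous_on UNIV f}"

definition linear_subspace_C :: "('x::topological_space \<Rightarrow> real) set \<Rightarrow> bool"
  where "linear_subspace_C V \<longleftrightarrow>
    V \<subseteq> continuous_functions \<and>
    (\<lambda>x. 0) \<in> V \<and>
    (\<forall>f\<in>V. \<forall>g\<in>V. (\<lambda>x. f x + g x) \<in> V) \<and>
    (\<forall>c. \<forall>f\<in>V. (\<lambda>x. c * f x) \<in> V)"

definition riesz_ideal :: "('x::topological_space \<Rightarrow> real) set \<Rightarrow> bool"
  where "riesz_ideal I \<longleftrightarrow>
    linear_subspace_C I \<and>
    (\<forall>f\<in>continuous_functions. \<forall>g\<in>I. (\<forall>x. \<bar>f x\<bar> \<le> \<bar>g x\<bar>) \<longrightarrow> f \<in> I)"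

definition unital_subalgebra :: "('x::topological_space \<Rightarrow> real) set \<Rightarrow> bool"
  where "unital_subalgebra B \<longleftrightarrow>
    linear_subspace_C B \<and>
    (\<forall>f\<in>B. \<forall>g\<in>B. (\<lambda>x. f x * g x) \<in> B) \<and>
    (\<lambda>x. 1) \<in> B"

definition point_separating :: "('x \<Rightarrow> real) set \<Rightarrow> bool"
  where "point_separating S \<longleftrightarrow> (\<forall>x y. x \<noteq> y \<longrightarrow> (\<exists>s\<in>S. s x \<noteq> s y))"

text \<open>
  A map on a set \<open>I\<close> of functions is represented by a total function, of which only the values
  on \<open>I\<close> matter.
\<close>
definition linear_map_on ::
  "('x \<Rightarrow> real) set \<Rightarrow> (('x \<Rightarrow> real) \<Rightarrow> 'a::real_vector) \<Rightarrow> bool"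
  where "linear_map_on I \<Phi> \<longleftrightarrow>
    (\<forall>f\<in>I. \<forall>g\<in>I. \<Phi> (\<lambda>x. f x + g x) = \<Phi> f + \<Phi> g) \<and>
    (\<forall>c. \<forall>f\<in>I. \<Phi> (\<lambda>x. c * f x) = c *\<^sub>R \<Phi> f)"

definition unital_algebra_morphism_on ::
  "('x \<Rightarrow> real) set \<Rightarrow> (('x \<Rightarrow> real) \<Rightarrow> 'a::ordered_unital_algebra) \<Rightarrow> bool"
  where "unital_algebra_morphism_on I \<Phi> \<longleftrightarrow>
    linear_map_on I \<Phi> \<and>
    (\<forall>f\<in>I. \<forall>g\<in>I. \<Phi> (\<lambda>x. f x * g x) = \<Phi> f * \<Phi> g) \<and>
    \<Phi> (\<lambda>x. 1) = 1"

text \<open>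
  Strict continuity is meant for positive linear maps. Positivity is not part of the predicate,
  because it is automatic for unital algebra morphisms on a Riesz ideal \<open>I\<close> that is a unital
  subalgebra: if \<open>0 \<le> f \<in> I\<close>, then \<open>sqrt f \<le> 1 + f\<close> yields \<open>sqrt f \<in> I\<close>, so \<open>\<Phi> f\<close> is the
  square of \<open>\<Phi> (sqrt f)\<close>. Decreasing sequences of functions refer to the pointwise order.
  Infima are expressed by \<open>isGlb\<close>, also in the reals, where \<open>Inf\<close> of a set that is not bounded
  below is an unspecified number.
\<close>
definition strictly_continuous_on ::
  "('x \<Rightarrow> real) set \<Rightarrow> (('x \<Rightarrow> real) \<Rightarrow> 'a::ordered_unital_algebra) \<Rightarrow> bool"
  where "strictly_continuous_on I \<Phi> \<longleftrightarrow>
    (\<forall>f :: nat \<Rightarrow> 'x \<Rightarrow> real.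
      (\<forall>k. f k \<in> I) \<longrightarrow> decseq f \<longrightarrow> (\<forall>x. isGlb UNIV (range (\<lambda>k. f k x)) 0) \<longrightarrow>
      isGlb UNIV (range (\<lambda>k. \<Phi> (f k))) 0)"

end

theory Submission
  imports Defs
begin

text \<open>
  Let \<open>J\<close> be the set of all \<open>f\<close> in \<open>I\<close> with \<open>\<Phi> f = \<Psi> f\<close>. It is a unital subalgebra of \<open>I\<close>, and
  it separates the points because it contains \<open>S\<close>; the task is to show that it is all of \<open>I\<close>.
  The algebra \<open>\<A>\<close> of values need not have a norm or suprema, so the only available limit process
  is squeezing: if elements \<open>u\<^sub>n\<close> of \<open>J\<close> satisfy \<open>f \<le> u\<^sub>n \<le> f + d\<^sub>n\<close> with \<open>d\<^sub>n\<close> in \<open>I\<close> decreasing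
  pointwise to \<open>0\<close>, then \<open>\<Psi> f \<le> \<Psi> u\<^sub>n = \<Phi> u\<^sub>n \<le> \<Phi> f + \<Phi> d\<^sub>n\<close>, and strict continuity gives
  \<open>\<Psi> f \<le> \<Phi> f\<close>; by symmetry \<open>f\<close> belongs to \<open>J\<close> (\<open>agreement_squeeze\<close>).

  Approximations on compact sets come from the Stone-Weierstrass theorem, but they have to be
  controlled on the whole space, which calls for bounded functions and lattice operations. Since
  inverses in \<open>\<A>\<close> are unique, \<open>J\<close> contains \<open>1 / (1 + g\<^sup>2)\<close> and \<open>g / (1 + g\<^sup>2)\<close> along with \<open>g\<close>, and
  these two bounded functions separate the points that \<open>g\<close> separates
  (\<open>bounded_agreement_separates\<close>). The bounded part of \<open>J\<close> is closed under composition with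
  continuous functions \<open>\<real> \<rightarrow> \<real>\<close> by approximation with functions \<open>p\<close> for which \<open>p \<circ> g\<close> is in \<open>J\<close>
  (\<open>bounded_agreement_compose\<close>); in particular it is a lattice.

  If \<open>f \<ge> 0\<close> is continuous and vanishes off a compact set \<open>K\<close>, then for every compact \<open>L \<supseteq> K\<close>
  and \<open>e > 0\<close> there is a bounded \<open>g\<close> in \<open>J\<close> with \<open>f \<le> g \<le> f + e\<close> on \<open>L\<close>. Its positive part
  is above \<open>f\<close> everywhere, as \<open>f\<close> is zero off \<open>L\<close>. A locally compact Lindelof space
  is exhausted by countably many compact sets, and minima of such functions, for growing \<open>L\<close> and
  shrinking \<open>e\<close>, decrease pointwise to \<open>f\<close>; hence \<open>f\<close> is in \<open>J\<close> (\<open>agreement_compact_support\<close>).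
  Finally, an arbitrary \<open>f \<ge> 0\<close> in \<open>I\<close> is the increasing limit of the products \<open>\<eta>\<^sub>n f\<close> with
  compactly supported cutoff functions \<open>\<eta>\<^sub>n\<close> increasing to \<open>1\<close> (\<open>exhausting_cutoffs\<close>), and a
  general \<open>f\<close> is the difference of its positive and negative parts.
\<close>

section \<open>Cutoff functions on locally compact Lindelof spaces\<close>

lemma compactly_supported_bump:
  fixes x :: "'x::t2_space"
  assumes lc: "locally_compact_space (euclidean :: 'x topology)"
  obtains \<phi> :: "'x \<Rightarrow> real" and L where "continuous_on UNIV \<phi>" "\<And>y. 0 \<le> \<phi> y" "0 < \<phi> x"
    "compact L" "\<And>y. y \<notin> L \<Longrightarrow> \<phi> y = 0"
proof -
  have "Hausdorff_space (euclidean :: 'x topology)"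
    unfolding Hausdorff_space_def using hausdorff by (auto simp: disjnt_def)
  then have "completely_regular_space (euclidean :: 'x topology)"
    using lc locally_compact_regular_imp_completely_regular_space by blast
  moreover have "\<exists>U L. open U \<and> compact L \<and> x \<in> U \<and> U \<subseteq> L"
    using lc unfolding locally_compact_space_def by simp
  then obtain U L where U: "open U" "compact L" "x \<in> U" "U \<subseteq> L"
    by blast
  ultimately obtain f :: "'x \<Rightarrow> real" where
    f: "continuous_map euclidean (top_of_set {0..1}) f" "f x = 0" "f ` (- U) \<subseteq> {1}"
    unfolding completely_regular_space_def
    by (metis Diff_iff UNIV_I closed_Compl closed_closedin ComplD topspace_euclidean)
  have cont: "continuous_on UNIV f" and range: "\<And>y. f y \<in> {0..1}"
    using f(1) by (auto simp: continuous_map_in_subtopology)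
  show thesis
  proof
    show "continuous_on UNIV (\<lambda>y. 1 - f y)"
      by (intro continuous_intros cont)
  qed (use U f range in auto)
qed

text \<open>
  The sets where the bumps are positive form an open cover, so countably many bumps suffice;
  their partial sums, multiplied by growing factors and cut off at \<open>1\<close>, are the required functions.
\<close>
lemma exhausting_cutoffs:
  assumes lind: "Lindelof_space (euclidean :: ('x::t2_space) topology)"
    and lc: "locally_compact_space (euclidean :: ('x::t2_space) topology)"
  obtains K :: "nat \<Rightarrow> ('x::t2_space) set" and \<eta> :: "nat \<Rightarrow> 'x::t2_space \<Rightarrow> real" where
    "\<And>n. compact (K n)" "incseq K" "\<And>x. \<exists>n. x \<in> K n"
    "\<And>n. continuous_on UNIV (\<eta> n)" "\<And>n x. 0 \<le> \<eta> n x" "\<And>n x. \<eta> n x \<le> 1"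
    "\<And>n x. x \<notin> K n \<Longrightarrow> \<eta> n x = 0"
    "\<And>x. incseq (\<lambda>n. \<eta> n x)" "\<And>x. (\<lambda>n. \<eta> n x) \<longlonglongrightarrow> 1"
proof -
  have "\<exists>\<phi> L. continuous_on UNIV \<phi> \<and> (\<forall>y. 0 \<le> (\<phi> y :: real)) \<and> 0 < \<phi> x \<and> compact L \<and>
      (\<forall>y. y \<notin> L \<longrightarrow> \<phi> y = 0)" for x :: 'x
    by (rule compactly_supported_bump[OF lc, of x]) blast
  then obtain \<phi> :: "'x \<Rightarrow> 'x \<Rightarrow> real" and L where
    \<phi>: "\<And>x. continuous_on UNIV (\<phi> x)" "\<And>x y. 0 \<le> \<phi> x y" "\<And>x. 0 < \<phi> x x"
    and L: "\<And>x. compact (L x)" "\<And>x y. y \<notin> L x \<Longrightarrow> \<phi> x y = 0"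
    by metis
  define P where "P x = {y. 0 < \<phi> x y}" for x
  have "open (P x)" for x
    unfolding P_def by (intro open_Collect_less continuous_on_const \<phi>)
  moreover have "\<Union>(range P) = UNIV"
    using \<phi>(3) by (auto simp: P_def)
  ultimately have "\<exists>\<V>. countable \<V> \<and> \<V> \<subseteq> range P \<and> \<Union>\<V> = topspace euclidean"
    by (intro Lindelof_spaceD[OF lind]) auto
  then obtain \<V> where \<V>: "countable \<V>" "\<V> \<subseteq> range P" "\<Union>\<V> = UNIV"
    by auto
  then obtain T where T: "countable T" "\<V> = P ` T"
    using countable_subset_image[of \<V> P UNIV] by auto
  with \<V>(3) have "T \<noteq> {}"
    by auto
  with T obtain e :: "nat \<Rightarrow> 'x" where e: "T = range e"
    using range_from_nat_into by metis
  have cover: "\<exists>k. 0 < \<phi> (e k) x" for x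
    using \<V>(3) T(2) e by (auto simp: P_def set_eq_iff)
  define \<sigma> where "\<sigma> n x = (\<Sum>k<n. \<phi> (e k) x)" for n x
  define \<eta> where "\<eta> n x = min 1 (real n * \<sigma> n x)" for n x
  define K where "K n = (\<Union>k<n. L (e k))" for n
  have \<sigma>_nonneg: "0 \<le> \<sigma> n x" for n x
    unfolding \<sigma>_def by (intro sum_nonneg \<phi>)
  have \<sigma>_mono: "\<sigma> m x \<le> \<sigma> n x" if "m \<le> n" for m n x
    unfolding \<sigma>_def using that by (intro sum_mono2 \<phi>) auto
  show thesis
  proof (rule that[of K \<eta>])
    show "compact (K n)" for n
      unfolding K_def using L by (intro compact_UN) auto
    show "incseq K"
      unfolding K_def incseq_def by force
    show "\<exists>n. x \<in> K n" for x
      using cover[of x] L(2)[of x] unfolding K_def by (metis UN_I lessI lessThan_iff less_irrefl)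
    show "continuous_on UNIV (\<eta> n)" for n
      unfolding \<eta>_def[abs_def] \<sigma>_def by (intro continuous_intros \<phi>)
    show "0 \<le> \<eta> n x" "\<eta> n x \<le> 1" for n x
      using \<sigma>_nonneg by (auto simp: \<eta>_def)
    show "\<eta> n x = 0" if "x \<notin> K n" for n x
    proof -
      have "\<sigma> n x = 0"
        unfolding \<sigma>_def using that L(2) by (intro sum.neutral) (auto simp: K_def)
      then show ?thesis
        by (simp add: \<eta>_def)
    qed
    show "incseq (\<lambda>n. \<eta> n x)" for x
      unfolding incseq_def \<eta>_def using \<sigma>_nonneg \<sigma>_mono
      by (intro allI impI min.mono mult_mono) auto
    show "(\<lambda>n. \<eta> n x) \<longlonglongrightarrow> 1" for x
    proof -
      obtain k where k: "0 < \<phi> (e k) x"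
        using cover by blast
      obtain N :: nat where N: "1 / \<phi> (e k) x < real N"
        using reals_Archimedean2 by blast
      have "\<eta> n x = 1" if "n \<ge> max N (Suc k)" for n
      proof -
        have "\<phi> (e k) x \<le> \<sigma> n x"
          unfolding \<sigma>_def using that by (intro member_le_sum \<phi>) auto
        have "1 \<le> real N * \<phi> (e k) x"
          using N k by (simp add: field_simps)
        also have "\<dots> \<le> real n * \<sigma> n x"
          using that k \<open>\<phi> (e k) x \<le> \<sigma> n x\<close> by (intro mult_mono) auto
        finally show ?thesis
          by (simp add: \<eta>_def)
      qed
      then have "eventually (\<lambda>n. \<eta> n x = 1) sequentially"
        by (rule eventually_sequentiallyI)
      then show ?thesis
        by (rule tendsto_eventually)
    qed
  qed
qed

section \<open>Strictly continuous morphisms\<close>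

lemma decseq_pointwise: "decseq d \<longleftrightarrow> (\<forall>x. decseq (\<lambda>n. d n x))"
  unfolding decseq_def unfolding le_fun_def by blast

locale riesz_ideal_algebra =
  fixes I :: "('x::topological_space \<Rightarrow> real) set"
  assumes ideal: "riesz_ideal I" and subalgebra: "unital_subalgebra I"
begin

lemma continuous: "f \<in> I \<Longrightarrow> continuous_on UNIV f"
  using ideal by (auto simp: riesz_ideal_def linear_subspace_C_def continuous_functions_def)

lemma add: "f \<in> I \<Longrightarrow> g \<in> I \<Longrightarrow> (\<lambda>x. f x + g x) \<in> I"
  using ideal by (auto simp: riesz_ideal_def linear_subspace_C_def)

lemma scale: "f \<in> I \<Longrightarrow> (\<lambda>x. c * f x) \<in> I"
  using ideal by (auto simp: riesz_ideal_def linear_subspace_C_def)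

lemma mult: "f \<in> I \<Longrightarrow> g \<in> I \<Longrightarrow> (\<lambda>x. f x * g x) \<in> I"
  using subalgebra by (auto simp: unital_subalgebra_def)

lemma const: "(\<lambda>x. c) \<in> I"
  using subalgebra scale[of "\<lambda>x. 1" c] by (auto simp: unital_subalgebra_def)

lemma diff: "f \<in> I \<Longrightarrow> g \<in> I \<Longrightarrow> (\<lambda>x. f x - g x) \<in> I"
  using add[of f "\<lambda>x. -1 * g x"] scale[of g "-1"] by simp

lemma dominated:
  assumes "continuous_on UNIV f" "g \<in> I" "\<And>x. \<bar>f x\<bar> \<le> \<bar>g x\<bar>"
  shows "f \<in> I"
  using ideal assms by (auto simp: riesz_ideal_def continuous_functions_def)

lemma bounded:
  assumes "continuous_on UNIV f" "\<And>x. \<bar>f x\<bar> \<le> M"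
  shows "f \<in> I"
proof (rule dominated[OF assms(1) const[of M]])
  show "\<bar>f x\<bar> \<le> \<bar>M\<bar>" for x
    using assms(2)[of x] by linarith
qed

end

locale strict_morphism = riesz_ideal_algebra I
  for I :: "('x::topological_space \<Rightarrow> real) set" +
  fixes \<Phi> :: "('x \<Rightarrow> real) \<Rightarrow> 'a::ordered_unital_algebra"
  assumes morphism: "unital_algebra_morphism_on I \<Phi>"
    and strict: "strictly_continuous_on I \<Phi>"
begin

lemma map_add: "f \<in> I \<Longrightarrow> g \<in> I \<Longrightarrow> \<Phi> (\<lambda>x. f x + g x) = \<Phi> f + \<Phi> g"
  using morphism by (auto simp: unital_algebra_morphism_on_def linear_map_on_def)

lemma map_scale: "f \<in> I \<Longrightarrow> \<Phi> (\<lambda>x. c * f x) = c *\<^sub>R \<Phi> f"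
  using morphism by (auto simp: unital_algebra_morphism_on_def linear_map_on_def)

lemma map_mult: "f \<in> I \<Longrightarrow> g \<in> I \<Longrightarrow> \<Phi> (\<lambda>x. f x * g x) = \<Phi> f * \<Phi> g"
  using morphism by (auto simp: unital_algebra_morphism_on_def)

lemma map_one: "\<Phi> (\<lambda>x. 1) = 1"
  using morphism by (auto simp: unital_algebra_morphism_on_def)

lemma map_const: "\<Phi> (\<lambda>x. c) = c *\<^sub>R 1"
  using map_scale[OF const[of 1], of c] map_one by simp

lemma map_diff: "f \<in> I \<Longrightarrow> g \<in> I \<Longrightarrow> \<Phi> (\<lambda>x. f x - g x) = \<Phi> f - \<Phi> g"
  using map_add[of f "\<lambda>x. -1 * g x"] map_scale[of g "-1"] scale[of g "-1"] by simp

text \<open>A nonnegative \<open>f\<close> has its square root in \<open>I\<close>, and squares in the algebra are nonnegative.\<close>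
lemma map_nonneg:
  assumes "f \<in> I" "\<And>x. 0 \<le> f x"
  shows "0 \<le> \<Phi> f"
proof -
  have "(\<lambda>x. sqrt (f x)) \<in> I"
  proof (rule dominated)
    show "continuous_on UNIV (\<lambda>x. sqrt (f x))"
      by (intro continuous_intros continuous assms)
    show "(\<lambda>x. 1 + f x) \<in> I"
      by (intro add const assms)
    show "\<bar>sqrt (f x)\<bar> \<le> \<bar>1 + f x\<bar>" for x
    proof -
      have "sqrt (f x) \<le> sqrt ((1 + f x)\<^sup>2)"
        using assms(2)[of x] by (intro real_sqrt_le_mono) (simp add: power2_eq_square algebra_simps)
      then show ?thesis
        using assms(2)[of x] by simp
    qed
  qed
  then have "\<Phi> f = (\<Phi> (\<lambda>x. sqrt (f x)))\<^sup>2"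
    using map_mult assms(2) by (simp add: power2_eq_square flip: map_mult)
  then show ?thesis
    by (simp add: square_nonneg)
qed

lemma map_mono:
  assumes "f \<in> I" "g \<in> I" "\<And>x. f x \<le> g x"
  shows "\<Phi> f \<le> \<Phi> g"
  using map_nonneg[of "\<lambda>x. g x - f x"] assms by (simp add: diff map_diff)

text \<open>This is the form in which strict continuity enters: the infimum is the greatest lower bound.\<close>
lemma le_null_sequence:
  assumes "\<And>n. d n \<in> I" "decseq d" "\<And>x. (\<lambda>n. d n x) \<longlonglongrightarrow> 0" "\<And>n. a \<le> \<Phi> (d n)"
  shows "a \<le> 0"
proof -
  have "isGlb UNIV (range (\<lambda>n. d n x)) 0" for x
  proof -
    have "decseq (\<lambda>n. d n x)"
      using assms(2) by (simp only: decseq_pointwise)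
    then have "0 \<le> d n x" for n
      using decseq_ge assms(3) by blast
    moreover have "y \<le> 0" if "\<And>n. y \<le> d n x" for y
      using LIMSEQ_le_const[OF assms(3)[of x]] that by blast
    ultimately show ?thesis
      by (auto simp: isGlb_def isLb_def greatestP_def setge_def setle_def)
  qed
  then have "isGlb UNIV (range (\<lambda>n. \<Phi> (d n))) 0"
    using strict assms(1,2) unfolding strictly_continuous_on_def by blast
  then show ?thesis
    using assms(4) by (auto simp: isGlb_def isLb_def greatestP_def setge_def setle_def)
qed

text \<open>The product of \<open>1 / (1 + g\<^sup>2)\<close> and \<open>1 + g\<^sup>2\<close> is \<open>1\<close> in \<open>I\<close>, hence so is that of their images.\<close>
lemma map_resolvent:
  assumes "g \<in> I"
  shows "(\<lambda>x. 1 / (1 + (g x)\<^sup>2)) \<in> I"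
    and "\<Phi> (\<lambda>x. 1 / (1 + (g x)\<^sup>2)) * (1 + \<Phi> g * \<Phi> g) = 1"
    and "(1 + \<Phi> g * \<Phi> g) * \<Phi> (\<lambda>x. 1 / (1 + (g x)\<^sup>2)) = 1"
proof -
  let ?h = "\<lambda>x. 1 / (1 + (g x)\<^sup>2)" and ?k = "\<lambda>x. 1 + g x * g x"
  have nz: "1 + (g x)\<^sup>2 \<noteq> 0" for x
    by (metis add_pos_nonneg less_irrefl zero_le_power2 zero_less_one)
  show h: "?h \<in> I"
  proof (rule bounded)
    show "continuous_on UNIV ?h"
      using nz by (intro continuous_intros continuous assms) auto
    show "\<bar>?h x\<bar> \<le> 1" for x
      by (simp add: divide_le_eq_1 add_pos_nonneg)
  qed
  have k: "?k \<in> I" and \<Phi>k: "\<Phi> ?k = 1 + \<Phi> g * \<Phi> g"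
    using assms by (auto intro: add const mult simp: map_add const mult map_mult map_one)
  have "(\<lambda>x. ?h x * ?k x) = (\<lambda>x. 1)" "(\<lambda>x. ?k x * ?h x) = (\<lambda>x. 1)"
    using nz by (auto simp: power2_eq_square)
  then show "\<Phi> ?h * (1 + \<Phi> g * \<Phi> g) = 1" "(1 + \<Phi> g * \<Phi> g) * \<Phi> ?h = 1"
    using map_mult[OF h k] map_mult[OF k h] by (simp_all add: \<Phi>k map_one)
qed

end

section \<open>The set on which two morphisms agree\<close>

locale strict_morphism_pair = \<Phi>: strict_morphism I \<Phi> + \<Psi>: strict_morphism I \<Psi>
  for I :: "('x::t2_space \<Rightarrow> real) set"
    and \<Phi> \<Psi> :: "('x \<Rightarrow> real) \<Rightarrow> 'a::ordered_unital_algebra"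
begin

definition agreement :: "('x \<Rightarrow> real) set"
  where "agreement = {f \<in> I. \<Phi> f = \<Psi> f}"

definition bounded_agreement :: "('x \<Rightarrow> real) set"
  where "bounded_agreement = {f \<in> agreement. \<exists>M. \<forall>x. \<bar>f x\<bar> \<le> M}"

lemma agreement_add: "f \<in> agreement \<Longrightarrow> g \<in> agreement \<Longrightarrow> (\<lambda>x. f x + g x) \<in> agreement"
  by (auto simp: agreement_def \<Phi>.add \<Phi>.map_add \<Psi>.map_add)

lemma agreement_diff: "f \<in> agreement \<Longrightarrow> g \<in> agreement \<Longrightarrow> (\<lambda>x. f x - g x) \<in> agreement"
  by (auto simp: agreement_def \<Phi>.diff \<Phi>.map_diff \<Psi>.map_diff)

lemma agreement_mult: "f \<in> agreement \<Longrightarrow> g \<in> agreement \<Longrightarrow> (\<lambda>x. f x * g x) \<in> agreement"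
  by (auto simp: agreement_def \<Phi>.mult \<Phi>.map_mult \<Psi>.map_mult)

lemma agreement_const: "(\<lambda>x. c) \<in> agreement"
  by (simp add: agreement_def \<Phi>.const \<Phi>.map_const \<Psi>.map_const)

lemma agreement_uminus:
  assumes "f \<in> agreement"
  shows "(\<lambda>x. - f x) \<in> agreement"
  using agreement_diff[OF agreement_const[of 0] assms] by simp

lemma agreement_squeeze:
  assumes f: "f \<in> I" and u: "\<And>n. u n \<in> agreement"
    and d: "\<And>n. d n \<in> I" "decseq d" "\<And>x. (\<lambda>n. d n x) \<longlonglongrightarrow> 0"
    and squeeze: "\<And>n x. f x \<le> u n x" "\<And>n x. u n x \<le> f x + d n x"
  shows "f \<in> agreement"
proof -
  have uI: "u n \<in> I" and eq: "\<Phi> (u n) = \<Psi> (u n)" for n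
    using u[of n] by (auto simp: agreement_def)
  have "\<Psi> f \<le> \<Psi> (u n)" "\<Phi> f \<le> \<Phi> (u n)" for n
    using f uI squeeze(1) by (auto intro: \<Phi>.map_mono \<Psi>.map_mono)
  moreover have "\<Phi> (u n) \<le> \<Phi> f + \<Phi> (d n)" "\<Psi> (u n) \<le> \<Psi> f + \<Psi> (d n)" for n
    using \<Phi>.map_mono[OF uI \<Phi>.add[OF f d(1)] squeeze(2)]
      \<Psi>.map_mono[OF uI \<Phi>.add[OF f d(1)] squeeze(2)]
    by (simp_all add: \<Phi>.map_add \<Psi>.map_add f d(1))
  ultimately have "\<Psi> f - \<Phi> f \<le> \<Phi> (d n)" "\<Phi> f - \<Psi> f \<le> \<Psi> (d n)" for n
    by (metis eq diff_le_eq add.commute order_trans)+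
  then have "\<Psi> f - \<Phi> f \<le> 0" "\<Phi> f - \<Psi> f \<le> 0"
    using \<Phi>.le_null_sequence \<Psi>.le_null_sequence d by blast+
  then show ?thesis
    using f by (simp add: agreement_def)
qed

text \<open>
  The image of \<open>1 / (1 + g\<^sup>2)\<close> is a two-sided inverse of the image of \<open>1 + g\<^sup>2\<close>, so it is
  determined by the latter.
\<close>
lemma agreement_resolvent:
  assumes "g \<in> agreement"
  shows "(\<lambda>x. 1 / (1 + (g x)\<^sup>2)) \<in> agreement"
proof -
  let ?h = "\<lambda>x. 1 / (1 + (g x)\<^sup>2)"
  have g: "g \<in> I" "\<Psi> g = \<Phi> g"
    using assms by (auto simp: agreement_def)
  have "\<Phi> ?h = \<Phi> ?h * ((1 + \<Phi> g * \<Phi> g) * \<Psi> ?h)"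
    using \<Psi>.map_resolvent(3)[OF g(1)] g(2) by simp
  also have "\<dots> = \<Psi> ?h"
    using \<Phi>.map_resolvent(2)[OF g(1)] by (simp flip: mult.assoc)
  finally show ?thesis
    using \<Phi>.map_resolvent(1)[OF g(1)] by (simp add: agreement_def)
qed

lemma bounded_agreement_separates:
  assumes "point_separating agreement" "x \<noteq> y"
  shows "\<exists>f\<in>bounded_agreement. f x \<noteq> f y"
proof -
  obtain g where g: "g \<in> agreement" "g x \<noteq> g y"
    using assms unfolding point_separating_def by blast
  let ?h = "\<lambda>x. 1 / (1 + (g x)\<^sup>2)" and ?k = "\<lambda>x. g x * (1 / (1 + (g x)\<^sup>2))"
  have pos: "0 < 1 + (g z)\<^sup>2" for z
    by (simp add: add_pos_nonneg)
  have "\<bar>?h z\<bar> \<le> 1" for z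
    by (simp add: divide_le_eq_1 add_pos_nonneg)
  then have h: "?h \<in> bounded_agreement"
    unfolding bounded_agreement_def using agreement_resolvent[OF g(1)] by blast
  have "\<bar>?k z\<bar> \<le> 1" for z
  proof -
    have "\<bar>g z\<bar> \<le> 1 + (g z)\<^sup>2"
      using zero_le_power2[of "\<bar>g z\<bar> - 1"] zero_le_power2[of "g z"]
      by (simp add: power2_diff)
    then show ?thesis
      using pos[of z] by (simp add: abs_mult divide_le_eq_1)
  qed
  then have k: "?k \<in> bounded_agreement"
    unfolding bounded_agreement_def
    using agreement_mult[OF g(1) agreement_resolvent[OF g(1)]] by blast
  have "?h x \<noteq> ?h y \<or> ?k x \<noteq> ?k y"
  proof (rule ccontr)
    assume "\<not> ?thesis"
    then have eq: "?h x = ?h y" "g x * ?h x = g y * ?h y"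
      by auto
    then have "g x * ?h y = g y * ?h y"
      by simp
    with g(2) pos[of y] show False
      by simp
  qed
  then show ?thesis
    by (elim disjE) (intro bexI[OF _ h] bexI[OF _ k], assumption)+
qed

text \<open>
  Polynomials in \<open>g\<close> lie in the agreement set. Instead of polynomials, the Stone-Weierstrass
  theorem on \<open>[-M, M]\<close> is applied to the algebra of all continuous \<open>p\<close> with \<open>p \<circ> g\<close> in the
  agreement set; it separates points as it contains the identity.
\<close>
lemma bounded_agreement_compose:
  assumes g: "g \<in> bounded_agreement" and h: "continuous_on UNIV (h :: real \<Rightarrow> real)"
  shows "(\<lambda>x. h (g x)) \<in> bounded_agreement"
proof -
  obtain M where gA: "g \<in> agreement" and M: "\<And>x. \<bar>g x\<bar> \<le> M"
    using g by (auto simp: bounded_agreement_def)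
  have gI: "g \<in> I"
    using gA by (simp add: agreement_def)
  have gM: "g x \<in> {-M..M}" for x
    using M[of x] by auto
  have hM: "continuous_on {-M..M} h"
    using h continuous_on_subset by blast
  have "bounded (h ` {-M..M})"
    by (intro compact_imp_bounded compact_continuous_image hM compact_Icc)
  then obtain B where "\<forall>t\<in>{-M..M}. \<bar>h t\<bar> \<le> B"
    unfolding bounded_iff by auto
  then have B: "\<bar>h (g x)\<bar> \<le> B" for x
    using gM by blast
  have hgI: "(\<lambda>x. h (g x)) \<in> I"
  proof (rule \<Phi>.bounded)
    show "continuous_on UNIV (\<lambda>x. h (g x))"
      by (rule continuous_on_compose2[OF h \<Phi>.continuous[OF gI]]) auto
  qed (rule B)
  define R where "R = {p. continuous_on UNIV p \<and> (\<lambda>x. p (g x)) \<in> agreement}"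
  interpret R: function_ring_on R "{-M..M}"
  proof
    show "\<exists>p\<in>R. p s \<noteq> p t" if "s \<noteq> t" for s t
      using that gA by (intro bexI[of _ id]) (auto simp: R_def id_def)
    show "continuous_on {-M..M} p" if "p \<in> R" for p
      using that continuous_on_subset by (auto simp: R_def)
  qed (auto simp: R_def agreement_add agreement_mult agreement_const intro!: continuous_intros)
  have "\<exists>p\<in>R. \<forall>t\<in>{-M..M}. h t \<le> p t \<and> p t \<le> h t + 2 / Suc n" for n
  proof -
    \<comment> \<open>Approximating \<open>h\<close> shifted up by the error keeps the approximations above \<open>h\<close>.\<close>
    have "continuous_on {-M..M} (\<lambda>t. h t + 1 / Suc n)"
      by (intro continuous_intros hM)
    from R.Stone_Weierstrass_basic[OF this, of "1 / Suc n"] obtain p where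
      p: "p \<in> R" "\<And>t. t \<in> {-M..M} \<Longrightarrow> \<bar>h t + 1 / Suc n - p t\<bar> < 1 / Suc n"
      by auto
    have "h t \<le> p t \<and> p t \<le> h t + 2 / Suc n" if "t \<in> {-M..M}" for t
    proof -
      have "2 / real (Suc n) = 1 / Suc n + 1 / Suc n"
        by (simp only: flip: add_divide_distrib) simp
      with p(2)[OF that] show ?thesis
        unfolding abs_less_iff by linarith
    qed
    with p(1) show ?thesis
      by blast
  qed
  then obtain p where p: "\<And>n. p n \<in> R"
    "\<And>n t. t \<in> {-M..M} \<Longrightarrow> h t \<le> p n t"
    "\<And>n t. t \<in> {-M..M} \<Longrightarrow> p n t \<le> h t + 2 / Suc n"
    by metis
  have "(\<lambda>x. h (g x)) \<in> agreement"
  proof (rule agreement_squeeze[OF hgI, where u = "\<lambda>n x. p n (g x)"])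
    show "(\<lambda>x. p n (g x)) \<in> agreement" for n
      using p(1) by (simp add: R_def)
    show "(\<lambda>x. 2 / Suc n) \<in> I" for n
      by (rule \<Phi>.const)
    show "decseq (\<lambda>n (x::'x). 2 / real (Suc n))"
      unfolding decseq_pointwise by (auto simp: decseq_def intro!: divide_left_mono)
    show "(\<lambda>n. 2 / real (Suc n)) \<longlonglongrightarrow> 0"
      using tendsto_mult_right_zero[OF lim_inverse_n', of 2] by (intro LIMSEQ_Suc) simp
  qed (use p gM in auto)
  with B show ?thesis
    unfolding bounded_agreement_def by blast
qed

lemma bounded_agreement_add:
  assumes "f \<in> bounded_agreement" "g \<in> bounded_agreement"
  shows "(\<lambda>x. f x + g x) \<in> bounded_agreement"
proof -
  obtain M N where "\<And>x. \<bar>f x\<bar> \<le> M" "\<And>x. \<bar>g x\<bar> \<le> N"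
    using assms by (auto simp: bounded_agreement_def)
  then have "\<bar>f x + g x\<bar> \<le> M + N" for x
    by (meson abs_triangle_ineq add_mono order_trans)
  then show ?thesis
    using assms agreement_add unfolding bounded_agreement_def by blast
qed

lemma bounded_agreement_mult:
  assumes "f \<in> bounded_agreement" "g \<in> bounded_agreement"
  shows "(\<lambda>x. f x * g x) \<in> bounded_agreement"
proof -
  obtain M N where "\<And>x. \<bar>f x\<bar> \<le> M" "\<And>x. \<bar>g x\<bar> \<le> N"
    using assms by (auto simp: bounded_agreement_def)
  then have "\<bar>f x * g x\<bar> \<le> M * N" for x
    by (simp add: abs_mult) (meson abs_ge_zero mult_mono order_trans)
  then show ?thesis
    using assms agreement_mult unfolding bounded_agreement_def by blast
qed

lemma bounded_agreement_const: "(\<lambda>x. c) \<in> bounded_agreement"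
  unfolding bounded_agreement_def using agreement_const by blast

lemma bounded_agreement_uminus: "f \<in> bounded_agreement \<Longrightarrow> (\<lambda>x. - f x) \<in> bounded_agreement"
  by (erule bounded_agreement_compose) (intro continuous_intros)

lemma bounded_agreement_pos_part:
  "f \<in> bounded_agreement \<Longrightarrow> (\<lambda>x. max 0 (f x)) \<in> bounded_agreement"
  by (erule bounded_agreement_compose) (intro continuous_intros)

lemma bounded_agreement_min:
  assumes "f \<in> bounded_agreement" "g \<in> bounded_agreement"
  shows "(\<lambda>x. min (f x) (g x)) \<in> bounded_agreement"
proof -
  have "(\<lambda>x. f x + - max 0 (f x + - g x)) \<in> bounded_agreement"
    by (intro bounded_agreement_add bounded_agreement_uminus bounded_agreement_pos_part assms)
  moreover have "(\<lambda>x. f x + - max 0 (f x + - g x)) = (\<lambda>x. min (f x) (g x))"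
    by (auto simp: min_def max_def)
  ultimately show ?thesis
    by simp
qed

section \<open>Compactly supported functions\<close>

lemma approximation_from_above:
  assumes sep: "point_separating agreement"
    and f: "continuous_on UNIV f" "\<And>x. 0 \<le> f x"
    and L: "compact L" "\<And>x. x \<notin> L \<Longrightarrow> f x = 0"
    and e: "0 < e"
  shows "\<exists>g\<in>bounded_agreement. (\<forall>x. f x \<le> g x) \<and> (\<forall>x\<in>L. g x \<le> f x + e)"
proof -
  interpret R: function_ring_on bounded_agreement L
  proof
    show "continuous_on L g" if "g \<in> bounded_agreement" for g
      using that \<Phi>.continuous continuous_on_subset
      by (fastforce simp: bounded_agreement_def agreement_def)
  qed (simp_all add: L(1) sep bounded_agreement_add bounded_agreement_mult
      bounded_agreement_const bounded_agreement_separates)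
  have "continuous_on L (\<lambda>x. f x + e / 2)"
    using f(1) by (intro continuous_intros) (rule continuous_on_subset, auto)
  from R.Stone_Weierstrass_basic[OF this, of "e / 2"] e obtain g where
    g: "g \<in> bounded_agreement" and approx: "\<And>x. x \<in> L \<Longrightarrow> \<bar>f x + e / 2 - g x\<bar> < e / 2"
    by auto
  have above: "f x \<le> g x" and below: "g x \<le> f x + e" if "x \<in> L" for x
    using approx[OF that] unfolding abs_less_iff by linarith+
  show ?thesis
  proof (intro bexI conjI allI ballI)
    show "(\<lambda>x. max 0 (g x)) \<in> bounded_agreement"
      by (rule bounded_agreement_pos_part[OF g])
    show "f x \<le> max 0 (g x)" for x
      using above L(2)[of x] by (cases "x \<in> L") (auto simp: le_max_iff_disj)
    show "max 0 (g x) \<le> f x + e" if "x \<in> L" for x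
      using below[OF that] f(2)[of x] e by simp
  qed
qed

text \<open>
  The approximations come from above, and are close to \<open>f\<close> only on \<open>K n\<close>; pointwise convergence
  asks for no more, because every point lies in almost all \<open>K n\<close>. Elements of a point-separating
  algebra need not approximate \<open>f\<close> from below: if the rationals in \<open>[0, 1]\<close> carry the discrete
  topology, then the restriction of a continuous function on \<open>[0, 1]\<close> is nonpositive whenever it
  is below the indicator of a point.
\<close>
lemma agreement_compact_support:
  fixes K :: "nat \<Rightarrow> 'x set"
  assumes sep: "point_separating agreement"
    and K: "\<And>n. compact (K n)" "incseq K" "\<And>x. \<exists>n. x \<in> K n"
    and f: "continuous_on UNIV f" "\<And>x. 0 \<le> f x"
    and C: "compact C" "\<And>x. x \<notin> C \<Longrightarrow> f x = 0"
  shows "f \<in> agreement"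
proof -
  have "\<exists>g\<in>bounded_agreement. (\<forall>x. f x \<le> g x) \<and> (\<forall>x\<in>K n. g x \<le> f x + 1 / real (Suc n))" for n
  proof -
    have "\<exists>g\<in>bounded_agreement. (\<forall>x. f x \<le> g x) \<and>
        (\<forall>x\<in>C \<union> K n. g x \<le> f x + 1 / real (Suc n))"
      by (rule approximation_from_above[OF sep f]) (use K(1) C in \<open>simp_all add: compact_Un\<close>)
    then show ?thesis
      by blast
  qed
  then obtain v where v: "\<And>n. v n \<in> bounded_agreement" "\<And>n x. f x \<le> v n x"
    "\<And>n x. x \<in> K n \<Longrightarrow> v n x \<le> f x + 1 / real (Suc n)"
    by metis
  have "\<exists>u. \<forall>n. (u n \<in> bounded_agreement \<and> (\<forall>x. f x \<le> u n x) \<and> u n \<le> v n) \<and> u (Suc n) \<le> u n"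
  proof (rule dependent_nat_choice)
    show "\<exists>u. u \<in> bounded_agreement \<and> (\<forall>x. f x \<le> u x) \<and> u \<le> v 0"
      using v by blast
  next
    fix u n
    assume "u \<in> bounded_agreement \<and> (\<forall>x. f x \<le> u x) \<and> u \<le> v n"
    then show "\<exists>u'. (u' \<in> bounded_agreement \<and> (\<forall>x. f x \<le> u' x) \<and> u' \<le> v (Suc n)) \<and> u' \<le> u"
      using v by (intro exI[of _ "\<lambda>x. min (u x) (v (Suc n) x)"])
        (auto simp: bounded_agreement_min le_fun_def)
  qed
  then obtain u where u: "\<And>n. u n \<in> bounded_agreement" "\<And>n x. f x \<le> u n x" "\<And>n. u n \<le> v n"
    "decseq u"
    unfolding decseq_Suc_iff by blast
  have uA: "u n \<in> agreement" for n
    using u(1) by (simp add: bounded_agreement_def)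
  have fI: "f \<in> I"
  proof (rule \<Phi>.dominated[OF f(1)])
    show "u 0 \<in> I"
      using uA by (simp add: agreement_def)
    show "\<bar>f x\<bar> \<le> \<bar>u 0 x\<bar>" for x
      using f(2)[of x] u(2)[of x 0] by simp
  qed
  show ?thesis
  proof (rule agreement_squeeze[OF fI uA])
    show "(\<lambda>x. u n x - f x) \<in> I" for n
      using uA fI by (auto simp: agreement_def intro: \<Phi>.diff)
    show "decseq (\<lambda>n x. u n x - f x)"
      using u(4) unfolding decseq_pointwise by (auto simp: decseq_def)
    show "(\<lambda>n. u n x - f x) \<longlonglongrightarrow> 0" for x
    proof -
      obtain m where m: "x \<in> K m"
        using K(3) by blast
      have bound: "u n x - f x \<le> 1 / real (Suc n)" if "n \<ge> m" for n
      proof -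
        have "x \<in> K n"
          using m K(2) that by (auto simp: incseq_def)
        from v(3)[OF this] u(3)[of n] show ?thesis
          by (simp add: le_fun_def) (smt (verit))
      qed
      show ?thesis
      proof (rule tendsto_sandwich)
        show "\<forall>\<^sub>F n in sequentially. 0 \<le> u n x - f x"
          using u(2) by simp
        show "\<forall>\<^sub>F n in sequentially. u n x - f x \<le> 1 / real (Suc n)"
          using bound by (rule eventually_sequentiallyI)
        show "(\<lambda>n. 1 / real (Suc n)) \<longlonglongrightarrow> 0"
          using LIMSEQ_Suc[OF lim_1_over_n] by simp
      qed simp
    qed
  qed (use u(2) in auto)
qed

section \<open>Extension to the whole ideal\<close>

text \<open>
  The products \<open>\<eta>\<^sub>n f\<close> increase to \<open>f\<close>, so their negatives approach \<open>- f\<close> from above, as squeezing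
  demands.
\<close>
lemma agreement_nonneg:
  assumes lind: "Lindelof_space (euclidean :: 'x topology)"
    and lc: "locally_compact_space (euclidean :: 'x topology)"
    and sep: "point_separating agreement"
    and f: "f \<in> I" "\<And>x. 0 \<le> f x"
  shows "f \<in> agreement"
proof -
  obtain K :: "nat \<Rightarrow> 'x set" and \<eta> :: "nat \<Rightarrow> 'x \<Rightarrow> real" where
    K: "\<And>n. compact (K n)" "incseq K" "\<And>x. \<exists>n. x \<in> K n"
    and \<eta>: "\<And>n. continuous_on UNIV (\<eta> n)" "\<And>n x. 0 \<le> \<eta> n x" "\<And>n x. \<eta> n x \<le> 1"
      "\<And>n x. x \<notin> K n \<Longrightarrow> \<eta> n x = 0" "\<And>x. incseq (\<lambda>n. \<eta> n x)" "\<And>x. (\<lambda>n. \<eta> n x) \<longlonglongrightarrow> 1"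
    using exhausting_cutoffs[OF lind lc] by metis
  have \<eta>f: "(\<lambda>x. \<eta> n x * f x) \<in> agreement" for n
  proof (rule agreement_compact_support[OF sep K _ _ K(1)[of n]])
    show "continuous_on UNIV (\<lambda>x. \<eta> n x * f x)"
      by (intro continuous_intros \<eta> \<Phi>.continuous f)
  qed (use f \<eta> in auto)
  have "(\<lambda>x. - f x) \<in> agreement"
  proof (rule agreement_squeeze[where u = "\<lambda>n x. - (\<eta> n x * f x)"])
    show "(\<lambda>x. - f x) \<in> I"
      using \<Phi>.scale[OF f(1), of "-1"] by simp
    show "(\<lambda>x. - (\<eta> n x * f x)) \<in> agreement" for n
      by (rule agreement_uminus[OF \<eta>f])
    show "(\<lambda>x. f x - \<eta> n x * f x) \<in> I" for n
      using \<eta>f f(1) by (auto simp: agreement_def intro: \<Phi>.diff)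
    show "decseq (\<lambda>n x. f x - \<eta> n x * f x)"
      using \<eta>(5) f(2) unfolding decseq_pointwise
      by (auto simp: decseq_def incseq_def intro!: mult_right_mono)
    show "(\<lambda>n. f x - \<eta> n x * f x) \<longlonglongrightarrow> 0" for x
      using tendsto_diff[OF tendsto_const tendsto_mult_right[OF \<eta>(6)], of "f x" x "f x"] by simp
    show "- f x \<le> - (\<eta> n x * f x)" for n x
      using mult_right_mono[OF \<eta>(3) f(2), of n x] by simp
  qed simp
  from agreement_uminus[OF this] show ?thesis
    by simp
qed

lemma agreement_eq_ideal:
  assumes "Lindelof_space (euclidean :: 'x topology)"
    and "locally_compact_space (euclidean :: 'x topology)"
    and "point_separating agreement"
  shows "agreement = I"
proof
  show "I \<subseteq> agreement"
  proof
    fix f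
    assume f: "f \<in> I"
    have "(\<lambda>x. max 0 (f x)) \<in> I" "(\<lambda>x. max 0 (- f x)) \<in> I"
      by (auto intro!: \<Phi>.dominated[OF _ f] continuous_intros \<Phi>.continuous[OF f])
    then have "(\<lambda>x. max 0 (f x)) \<in> agreement" "(\<lambda>x. max 0 (- f x)) \<in> agreement"
      by (auto intro!: agreement_nonneg assms)
    then have "(\<lambda>x. max 0 (f x) - max 0 (- f x)) \<in> agreement"
      by (rule agreement_diff)
    moreover have "(\<lambda>x. max 0 (f x) - max 0 (- f x)) = f"
      by (auto simp: max_def)
    ultimately show "f \<in> agreement"
      by simp
  qed
qed (auto simp: agreement_def)

end

theorem corollary4p8:
  fixes I S :: "('x::t2_space \<Rightarrow> real) set"
    and \<Phi> \<Psi> :: "('x \<Rightarrow> real) \<Rightarrow> 'a::ordered_unital_algebra"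
  assumes "Lindelof_space (euclidean :: 'x topology)"
    and "locally_compact_space (euclidean :: 'x topology)"
    and "riesz_ideal I"
    and "unital_subalgebra I"
    and "unital_algebra_morphism_on I \<Phi>"
    and "unital_algebra_morphism_on I \<Psi>"
    and "strictly_continuous_on I \<Phi>"
    and "strictly_continuous_on I \<Psi>"
    and "S \<subseteq> I"
    and "point_separating S"
    and "\<forall>s\<in>S. \<Phi> s = \<Psi> s"
  shows "\<forall>f\<in>I. \<Phi> f = \<Psi> f"
proof -
  interpret strict_morphism_pair I \<Phi> \<Psi>
    by unfold_locales (use assms in auto)
  have "S \<subseteq> agreement"
    using assms(9,11) by (auto simp: agreement_def)
  then have "point_separating agreement"
    using assms(10) unfolding point_separating_def by blast
  then have "agreement = I"
    by (rule agreement_eq_ideal[OF assms(1,2)])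
  then show ?thesis
    by (auto simp: agreement_def)
qed

end
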